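(* Let $\vec\mu=\mu_1\times\mu_2$ and $\vec\nu=\nu_1\times\nu_2$ be positive measures on the space $X\times X$ and, for $i\in\{1,2\}$, let $K_i$ be a nonnegative function on $X\times X$. Let $T$ be the integral operator defined by, for any $(x,y)\in X\times X$, $$Tf(x,y):=\int_X\int_X K_1(x,s)K_2(y,t)f(s,t)\,d\mu_1(s)\,d\mu_2(t).$$ Suppose $\vec q=(q_1,q_2)\in[1,\infty)^2$. Let $\gamma_i,\delta_i$ be real numbers with $\gamma_i+\delta_i=1$ for $i\in\{1,2\}$. If there exist two positive functions $h_1,h_2$ on $X\times X$ and two positive constants $C_1,C_2$ such that for almost all $(x,y)\in X\times X$, $$\operatorname*{ess\,sup}_{(s,t)\in X\times X}[K_1(x,s)]^{\gamma_1}[K_2(y,t)]^{\gamma_2}h_1(s,t)\le C_1h_2(x,y)$$ and for almost all $(s,t)\in X\times X$, $$\int_X\Big[\int_X [K_1(x,s)]^{\delta_1q_1}[K_2(y,t)]^{\delta_2q_1}[h_2(x,y)]^{q_1}\,d\nu_1(x)\Big]^{q_2/q_1}d\nu_2(y)\le C_2[h_1(s,t)]^{q_2},$$ then $T:L^{\vec1}_{\vec\mu}\to L^{\vec q}_{\vec\nu}$ is bounded with $\|T\|_{L^{\vec1}_{\vec\mu}\to L^{\vec q}_{\vec\nu}}\le C_1C_2^{1/q_2}$, where $\vec1=(1,1)$.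
   Context: For $\vec p=(p_1,p_2)\in[1,\infty)^2$ and a product measure $\vec\mu=\mu_1\times\mu_2$ on $X\times X$, $L^{\vec p}_{\vec\mu}$ is the mixed-norm Lebesgue space of measurable $f$ on $X\times X$ with $$\|f\|_{L^{\vec p}_{\vec\mu}}=\Big\{\int_X\Big[\int_X|f(s,t)|^{p_1}\,d\mu_1(s)\Big]^{p_2/p_1}d\mu_2(t)\Big\}^{1/p_2}<\infty.$$ *)

theory Defs
  imports "HOL-Analysis.Analysis" "HOL-Probability.Essential_Supremum"
begin

text \<open>Real powers on \<open>[0, \<infinity>]\<close>. Unlike \<^const>\<open>powr\<close>, which has \<open>0 powr a = 0\<close> for every \<open>a\<close>, this
  follows the usual conventions \<open>x\<^sup>0 = 1\<close>, and \<open>0\<^sup>r = \<infinity>\<close>, \<open>\<infinity>\<^sup>r = 0\<close> for \<open>r < 0\<close>.\<close>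

definition ennpowr :: "ennreal \<Rightarrow> real \<Rightarrow> ennreal" (infixr "ennpowr" 80) where
  "x ennpowr r =
     (if r = 0 then 1
      else if x = 0 then (if r > 0 then 0 else top)
      else if x = top then (if r > 0 then top else 0)
      else ennreal (enn2real x powr r))"

definition mixed_norm ::
  "real \<Rightarrow> real \<Rightarrow> 'a measure \<Rightarrow> 'b measure \<Rightarrow> ('a \<times> 'b \<Rightarrow> complex) \<Rightarrow> ennreal" where
  "mixed_norm p1 p2 M1 M2 f =
     (\<integral>\<^sup>+ t. (\<integral>\<^sup>+ s. ennreal (cmod (f (s, t))) ennpowr p1 \<partial>M1) ennpowr (p2 / p1) \<partial>M2)
       ennpowr (1 / p2)"

definition mixed_Lp ::
  "real \<Rightarrow> real \<Rightarrow> 'a measure \<Rightarrow> 'b measure \<Rightarrow> ('a \<times> 'b \<Rightarrow> complex) set" where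
  "mixed_Lp p1 p2 M1 M2 =
     {f \<in> borel_measurable (M1 \<Otimes>\<^sub>M M2). mixed_norm p1 p2 M1 M2 f < top}"

text \<open>Elements of \<^const>\<open>mixed_Lp\<close> are functions rather than classes modulo null sets, so linearity
  of an operator is required almost everywhere only. Together with boundedness it makes the
  operator well defined on classes.\<close>

definition mixed_bounded ::
  "real \<Rightarrow> real \<Rightarrow> 'a measure \<Rightarrow> 'b measure \<Rightarrow> real \<Rightarrow> real \<Rightarrow> 'c measure \<Rightarrow> 'd measure
     \<Rightarrow> (('a \<times> 'b \<Rightarrow> complex) \<Rightarrow> ('c \<times> 'd \<Rightarrow> complex)) \<Rightarrow> bool" where
  "mixed_bounded p1 p2 M1 M2 q1 q2 N1 N2 T \<longleftrightarrow>
     (\<forall>f \<in> mixed_Lp p1 p2 M1 M2. T f \<in> mixed_Lp q1 q2 N1 N2) \<and>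
     (\<forall>f \<in> mixed_Lp p1 p2 M1 M2. \<forall>g \<in> mixed_Lp p1 p2 M1 M2.
        AE z in N1 \<Otimes>\<^sub>M N2. T (\<lambda>w. f w + g w) z = T f z + T g z) \<and>
     (\<forall>f \<in> mixed_Lp p1 p2 M1 M2. \<forall>c.
        AE z in N1 \<Otimes>\<^sub>M N2. T (\<lambda>w. c * f w) z = c * T f z) \<and>
     (\<exists>C::real. \<forall>f \<in> mixed_Lp p1 p2 M1 M2.
        mixed_norm q1 q2 N1 N2 (T f) \<le> ennreal C * mixed_norm p1 p2 M1 M2 f)"

definition mixed_opnorm ::
  "real \<Rightarrow> real \<Rightarrow> 'a measure \<Rightarrow> 'b measure \<Rightarrow> real \<Rightarrow> real \<Rightarrow> 'c measure \<Rightarrow> 'd measure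
     \<Rightarrow> (('a \<times> 'b \<Rightarrow> complex) \<Rightarrow> ('c \<times> 'd \<Rightarrow> complex)) \<Rightarrow> ennreal" where
  "mixed_opnorm p1 p2 M1 M2 q1 q2 N1 N2 T =
     (SUP f \<in> {f \<in> mixed_Lp p1 p2 M1 M2. mixed_norm p1 p2 M1 M2 f \<le> 1}.
        mixed_norm q1 q2 N1 N2 (T f))"

text \<open>The Bochner integral is total (it is \<open>0\<close> for non-integrable functions), so absolute
  convergence of the defining integral has to be stated separately wherever it matters.\<close>

definition kernel_integrand ::
  "('a \<times> 'a \<Rightarrow> real) \<Rightarrow> ('a \<times> 'a \<Rightarrow> real) \<Rightarrow> ('a \<times> 'a \<Rightarrow> complex)
     \<Rightarrow> 'a \<times> 'a \<Rightarrow> 'a \<times> 'a \<Rightarrow> complex" where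
  "kernel_integrand K1 K2 f =
     (\<lambda>(x, y) (s, t). complex_of_real (K1 (x, s)) * complex_of_real (K2 (y, t)) * f (s, t))"

definition kernel_operator ::
  "'a measure \<Rightarrow> 'a measure \<Rightarrow> ('a \<times> 'a \<Rightarrow> real) \<Rightarrow> ('a \<times> 'a \<Rightarrow> real)
     \<Rightarrow> ('a \<times> 'a \<Rightarrow> complex) \<Rightarrow> ('a \<times> 'a \<Rightarrow> complex)" where
  "kernel_operator M1 M2 K1 K2 f =
     (\<lambda>z. LINT t|M2. LINT s|M1. kernel_integrand K1 K2 f z (s, t))"

end

theory Submission
  imports Defs
begin

text \<open>Splitting \<open>K\<^sub>i = K\<^sub>i\<^sup>\<gamma> K\<^sub>i\<^sup>\<delta>\<close> and bounding \<open>K\<^sub>1\<^sup>\<gamma> K\<^sub>2\<^sup>\<gamma> h\<^sub>1\<close> by \<open>C\<^sub>1 h\<^sub>2\<close> for almost every \<open>(s, t)\<close> gives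
  \<open>|Tf| \<le> C\<^sub>1 \<integral>\<integral> h\<^sub>2 K\<^sub>1\<^sup>\<delta> K\<^sub>2\<^sup>\<delta> |f| / h\<^sub>1\<close>. Minkowski's integral inequality, applied first in \<open>x\<close> and
  then in \<open>y\<close>, moves the mixed norm inside the integral over \<open>(s, t)\<close>, where the second hypothesis
  bounds the norm of \<open>h\<^sub>2 K\<^sub>1\<^sup>\<delta> K\<^sub>2\<^sup>\<delta>\<close> by \<open>C\<^sub>2 powr (1/q\<^sub>2) h\<^sub>1\<close>, cancelling the weight.
  Minkowski's inequality follows from Jensen's inequality for the weight
  \<open>\<phi>(s) = \<parallel>F(\<cdot>, s)\<parallel>\<^sub>q\<close> applied to \<open>F / \<phi>\<close>; this needs neither duality nor truncation.\<close>

section \<open>Arithmetic of powers on the extended half-line\<close>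

lemma ennpowr_0 [simp]: "r > 0 \<Longrightarrow> 0 ennpowr r = 0"
  by (simp add: ennpowr_def)

lemma ennpowr_top [simp]: "r > 0 \<Longrightarrow> top ennpowr r = top"
  by (simp add: ennpowr_def)

lemma ennpowr_ennreal: "0 \<le> a \<Longrightarrow> r > 0 \<Longrightarrow> ennreal a ennpowr r = ennreal (a powr r)"
  by (auto simp: ennpowr_def ennreal_eq_0_iff)

lemma ennpowr_ennreal_pos: "0 < a \<Longrightarrow> ennreal a ennpowr r = ennreal (a powr r)"
  by (auto simp: ennpowr_def ennreal_eq_0_iff)

lemma ennpowr_one_right [simp]: "x ennpowr 1 = x"
  by (cases x) (auto simp: ennpowr_ennreal)

lemma ennpowr_eq_0_iff: "r > 0 \<Longrightarrow> x ennpowr r = 0 \<longleftrightarrow> x = 0"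
  by (cases x) (auto simp: ennpowr_ennreal ennreal_eq_0_iff)

lemma ennpowr_eq_top_iff: "r > 0 \<Longrightarrow> x ennpowr r = top \<longleftrightarrow> x = top"
  by (cases x) (auto simp: ennpowr_ennreal)

lemma ennpowr_mono: "r > 0 \<Longrightarrow> x \<le> y \<Longrightarrow> x ennpowr r \<le> y ennpowr r"
  by (cases x; cases y) (auto simp: ennpowr_ennreal top_unique intro!: ennreal_leI powr_mono2)

text \<open>Positivity of \<open>r\<close> matters: since \<open>0 * top = 0\<close>, a negative
  exponent at \<open>x = 0\<close>, \<open>y = top\<close> would give \<open>top\<close> on the left
  and \<open>0\<close> on the right.\<close>

lemma ennpowr_mult_distrib: "r > 0 \<Longrightarrow> (x * y) ennpowr r = x ennpowr r * y ennpowr r"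
  by (cases x; cases y; cases "x = 0"; cases "y = 0")
     (auto simp: ennpowr_ennreal ennreal_mult[symmetric] powr_mult ennreal_top_mult ennreal_mult_top
        ennreal_eq_0_iff)

text \<open>The inner exponent \<open>a\<close> may have any sign, because it will be
  \<open>\<delta>1\<close> or \<open>\<delta>2\<close>, about which only
  \<open>\<gamma>1 + \<delta>1 = 1\<close> and \<open>\<gamma>2 + \<delta>2 = 1\<close> are
  known.\<close>

lemma ennpowr_ennpowr: "r > 0 \<Longrightarrow> (x ennpowr a) ennpowr r = x ennpowr (a * r)"
  by (cases "x = 0"; cases x)
     (auto simp: ennpowr_def powr_powr ennreal_eq_0_iff mult_less_0_iff zero_less_mult_iff)

lemma measurable_ennpowr [measurable]:
  assumes [measurable]: "f \<in> borel_measurable M"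
  shows "(\<lambda>x. f x ennpowr r) \<in> borel_measurable M"
  unfolding ennpowr_def by measurable

section \<open>Jensen's and Minkowski's inequalities\<close>

text \<open>The right-hand side is the tangent at \<open>a\<^sup>q\<close> of the concave function \<open>v \<mapsto> v powr (1 / q)\<close>,
  evaluated at \<open>v = u\<^sup>q\<close>.\<close>

lemma ennpowr_tangent:
  fixes u :: ennreal and a q :: real
  assumes "a > 0" "q \<ge> 1"
  shows "u \<le> ennreal (a powr (1 - q) / q) * u ennpowr q + ennreal ((1 - 1 / q) * a)"
proof (cases u)
  case (real r)
  have "r \<le> a powr (1 - q) / q * r powr q + (1 - 1 / q) * a"
  proof (cases "q = 1")
    case False
    \<comment> \<open>Young's inequality for the factors \<open>r / a\<close> and \<open>1\<close>.
      The conjugate exponent \<open>q / (q - 1)\<close> makes sense only for \<open>q > 1\<close>;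
      for \<open>q = 1\<close> the bound is an equality.\<close>
    have "r / a * 1 \<le> (r / a) powr q / q + 1 powr (q / (q - 1)) / (q / (q - 1))"
      using False assms real by (intro Youngs_inequality) (auto simp: field_simps)
    also have "\<dots> = (r / a) powr q / q + (1 - 1 / q)"
      using False assms by (simp add: field_simps)
    finally have "r \<le> a * ((r / a) powr q / q + (1 - 1 / q))"
      using assms by (simp add: field_simps)
    also have "\<dots> = a powr (1 - q) / q * r powr q + (1 - 1 / q) * a"
      using assms real by (simp add: powr_divide powr_diff field_simps)
    finally show ?thesis .
  qed (use assms real in auto)
  then show ?thesis
    using assms real by (simp add: ennpowr_ennreal ennreal_mult[symmetric] ennreal_plus[symmetric]
        ennreal_leI del: ennreal_plus)
next
  case top
  then show ?thesis using assms by (simp add: ennreal_mult_top)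
qed

text \<open>Jensen's inequality for the probability density proportional to \<open>w\<close>,
  cleared of denominators. Integrating the tangent bound against \<open>w\<close> proves it
  directly, once the point of tangency is chosen well.\<close>

lemma nn_integral_ennpowr_le_weighted:
  fixes w u :: "'a \<Rightarrow> ennreal"
  assumes [measurable]: "w \<in> borel_measurable M" "u \<in> borel_measurable M" and q: "q \<ge> 1"
    and S: "(\<integral>\<^sup>+ x. w x \<partial>M) \<noteq> 0" "(\<integral>\<^sup>+ x. w x \<partial>M) \<noteq> top"
  shows "(\<integral>\<^sup>+ x. w x * u x \<partial>M) ennpowr q
           \<le> (\<integral>\<^sup>+ x. w x \<partial>M) ennpowr (q - 1) * (\<integral>\<^sup>+ x. w x * u x ennpowr q \<partial>M)"
proof -
  obtain S where S: "S > 0" "(\<integral>\<^sup>+ x. w x \<partial>M) = ennreal S"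
    using S by (cases "\<integral>\<^sup>+ x. w x \<partial>M") (auto simp: ennreal_eq_0_iff less_le)
  define I where "I = (\<integral>\<^sup>+ x. w x * u x ennpowr q \<partial>M)"
  \<comment> \<open>The point of tangency must be positive and finite, so the two extreme values of
    \<open>I\<close> are treated separately.\<close>
  consider "I = 0" | "I = top" | i where "i > 0" "I = ennreal i"
    by (cases I) (auto simp: ennreal_eq_0_iff less_le)
  then show ?thesis
  proof cases
    case 1
    then have "AE x in M. w x * u x = 0"
      unfolding I_def using q by (subst (asm) nn_integral_0_iff_AE) (auto simp: ennpowr_eq_0_iff)
    then have "(\<integral>\<^sup>+ x. w x * u x \<partial>M) = 0"
      by (subst nn_integral_0_iff_AE) auto
    then show ?thesis using q by simp
  next
    case 2
    have "ennreal S ennpowr (q - 1) \<noteq> 0"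
      using S by (simp add: ennpowr_ennreal_pos ennreal_eq_0_iff)
    then show ?thesis using 2 S unfolding I_def by (simp add: ennreal_mult_top)
  next
    case 3
    \<comment> \<open>this point of tangency is the weighted \<open>q\<close>-mean of \<open>u\<close>, which makes the integrated bound equal to \<open>a * S\<close>\<close>
    define a where "a = (i / S) powr (1 / q)"
    have a: "a > 0" using 3 S by (simp add: a_def)
    have aq: "a powr q = i / S" using 3 S q by (simp add: a_def powr_powr)
    define c where "c = a powr (1 - q) / q"
    define d where "d = (1 - 1 / q) * a"
    have cd: "c \<ge> 0" "d \<ge> 0" using a q by (auto simp: c_def d_def)
    have "(\<integral>\<^sup>+ x. w x * u x \<partial>M)
        \<le> (\<integral>\<^sup>+ x. ennreal c * (w x * u x ennpowr q) + ennreal d * w x \<partial>M)"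
    proof (rule nn_integral_mono)
      fix x
      have "w x * u x \<le> w x * (ennreal c * u x ennpowr q + ennreal d)"
        using ennpowr_tangent[OF a q] by (intro mult_left_mono) (auto simp: c_def d_def)
      then show "w x * u x \<le> ennreal c * (w x * u x ennpowr q) + ennreal d * w x"
        by (simp add: algebra_simps)
    qed
    also have "\<dots> = ennreal c * I + ennreal d * ennreal S"
      using S by (simp add: nn_integral_add nn_integral_cmult I_def)
    also have "\<dots> = ennreal (c * i + d * S)"
      using 3 S cd by (simp add: ennreal_mult ennreal_plus)
    also have "c * i + d * S = a * S"
    proof -
      have "i = a powr q * S" using aq S by simp
      then have "c * i = a * S / q" using a by (simp add: c_def powr_diff)
      then show ?thesis by (simp add: d_def algebra_simps)
    qed
    finally have "(\<integral>\<^sup>+ x. w x * u x \<partial>M) ennpowr q \<le> ennreal (a * S) ennpowr q"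
      using q by (intro ennpowr_mono) auto
    also have "\<dots> = ennreal (S powr (q - 1) * i)"
      using a S q 3 by (simp add: ennpowr_ennreal powr_mult aq powr_diff field_simps)
    also have "\<dots> = ennreal S ennpowr (q - 1) * I"
      using S 3 by (simp add: ennpowr_ennreal_pos ennreal_mult)
    finally show ?thesis using S by (simp add: I_def)
  qed
qed

text \<open>Dividing by \<open>\<phi> s\<close> normalises each slice \<open>F _ s\<close> to have
  norm at most 1. Jensen with weight \<open>\<phi>\<close> and Fubini then leave
  \<open>S ennpowr (q - 1) * S\<close>, where \<open>S\<close> is the integral of
  \<open>\<phi>\<close>.\<close>

lemma nn_integral_Minkowski:
  fixes F :: "'a \<Rightarrow> 'b \<Rightarrow> ennreal"
  assumes "sigma_finite_measure M" "sigma_finite_measure N"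
    and F: "case_prod F \<in> borel_measurable (N \<Otimes>\<^sub>M M)" and q: "q \<ge> 1"
  shows "(\<integral>\<^sup>+ x. (\<integral>\<^sup>+ s. F x s \<partial>M) ennpowr q \<partial>N) ennpowr (1 / q)
           \<le> (\<integral>\<^sup>+ s. (\<integral>\<^sup>+ x. F x s ennpowr q \<partial>N) ennpowr (1 / q) \<partial>M)"
proof -
  interpret M: sigma_finite_measure M by fact
  interpret N: sigma_finite_measure N by fact
  interpret P: pair_sigma_finite N M ..
  note [measurable] = F
  define \<phi> where "\<phi> s = (\<integral>\<^sup>+ x. F x s ennpowr q \<partial>N) ennpowr (1 / q)" for s
  have [measurable]: "\<phi> \<in> borel_measurable M" unfolding \<phi>_def by measurable
  have \<phi>q: "\<phi> s ennpowr q = (\<integral>\<^sup>+ x. F x s ennpowr q \<partial>N)" for s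
    using q by (simp add: \<phi>_def ennpowr_ennpowr)
  \<comment> \<open>The factorisation can fail where \<open>\<phi>\<close> is \<open>0\<close> or
    \<open>top\<close>. Finiteness of the integral confines \<open>top\<close> to a null set, and
    where \<open>\<phi> s = 0\<close> the slice \<open>F _ s\<close> vanishes almost
    everywhere.\<close>
  have int_F: "AE x in N. (\<integral>\<^sup>+ s. F x s \<partial>M) = (\<integral>\<^sup>+ s. \<phi> s * (F x s / \<phi> s) \<partial>M)"
    if fin: "(\<integral>\<^sup>+ s. \<phi> s \<partial>M) \<noteq> top"
  proof -
    have "AE s in M. \<phi> s \<noteq> top"
      using nn_integral_PInf_AE[of \<phi> M] fin by auto
    then have "AE s in M. AE x in N. F x s = \<phi> s * (F x s / \<phi> s)"
      using AE_space
    proof eventually_elim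
      case (elim s)
      note [measurable] = \<open>s \<in> space M\<close>
      show ?case
      proof (cases "\<phi> s = 0")
        case True
        then have "(\<integral>\<^sup>+ x. F x s ennpowr q \<partial>N) = 0"
          using \<phi>q[of s] q by simp
        then have "AE x in N. F x s = 0"
          using q by (subst (asm) nn_integral_0_iff_AE) (auto simp: ennpowr_eq_0_iff)
        then show ?thesis by eventually_elim simp
      next
        case False
        then show ?thesis using elim
          by (simp add: ennreal_times_divide mult.commute[of "\<phi> s"] ennreal_mult_divide_eq)
      qed
    qed
    \<comment> \<open>The exceptional set of \<open>x\<close> depends on \<open>s\<close>.
      Exchanging the quantifiers gives, for almost every \<open>x\<close>, an identity that can be
      integrated in \<open>s\<close>.\<close>
    then have "AE x in N. AE s in M. F x s = \<phi> s * (F x s / \<phi> s)"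
      by (subst P.AE_commute) auto
    then show ?thesis
      by eventually_elim (rule nn_integral_cong_AE)
  qed
  define S where "S = (\<integral>\<^sup>+ s. \<phi> s \<partial>M)"
  consider "S = top" | "S = 0" | "S \<noteq> 0" "S \<noteq> top" by blast
  then have "(\<integral>\<^sup>+ x. (\<integral>\<^sup>+ s. F x s \<partial>M) ennpowr q \<partial>N) \<le> S ennpowr q"
  proof cases
    case 1
    then show ?thesis using q by simp
  next
    case 2
    then have "AE s in M. \<phi> s = 0"
      unfolding S_def by (subst (asm) nn_integral_0_iff_AE) auto
    then have "(\<integral>\<^sup>+ s. \<phi> s * (F x s / \<phi> s) \<partial>M) = 0" if "x \<in> space N" for x
      using that by (subst nn_integral_0_iff_AE) auto
    then have "AE x in N. (\<integral>\<^sup>+ s. F x s \<partial>M) = 0"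
      using int_F 2 unfolding S_def by auto
    then have "(\<integral>\<^sup>+ x. (\<integral>\<^sup>+ s. F x s \<partial>M) ennpowr q \<partial>N) = 0"
      using q by (subst nn_integral_0_iff_AE) (auto simp: ennpowr_eq_0_iff)
    then show ?thesis by simp
  next
    case 3
    have "(\<integral>\<^sup>+ x. (\<integral>\<^sup>+ s. F x s \<partial>M) ennpowr q \<partial>N)
        = (\<integral>\<^sup>+ x. (\<integral>\<^sup>+ s. \<phi> s * (F x s / \<phi> s) \<partial>M) ennpowr q \<partial>N)"
      using int_F 3 unfolding S_def by (intro nn_integral_cong_AE) auto
    also have "\<dots> \<le> (\<integral>\<^sup>+ x. S ennpowr (q - 1) * (\<integral>\<^sup>+ s. \<phi> s * (F x s / \<phi> s) ennpowr q \<partial>M) \<partial>N)"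
      using 3 q unfolding S_def
      by (intro nn_integral_mono nn_integral_ennpowr_le_weighted) auto
    also have "\<dots> = S ennpowr (q - 1) * (\<integral>\<^sup>+ s. (\<integral>\<^sup>+ x. \<phi> s * (F x s / \<phi> s) ennpowr q \<partial>N) \<partial>M)"
      by (subst nn_integral_cmult, measurable, subst P.Fubini') auto
    also have "\<dots> = S ennpowr (q - 1) * (\<integral>\<^sup>+ s. \<phi> s * (\<integral>\<^sup>+ x. (F x s / \<phi> s) ennpowr q \<partial>N) \<partial>M)"
      by (auto intro!: arg_cong[where f="\<lambda>z. _ * z"] nn_integral_cong nn_integral_cmult)
    also have "\<dots> \<le> S ennpowr (q - 1) * (\<integral>\<^sup>+ s. \<phi> s * 1 \<partial>M)"
    proof (intro mult_left_mono nn_integral_mono)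
      fix s assume [measurable]: "s \<in> space M"
      have "(\<integral>\<^sup>+ x. (F x s / \<phi> s) ennpowr q \<partial>N) = (\<integral>\<^sup>+ x. F x s ennpowr q * inverse (\<phi> s) ennpowr q \<partial>N)"
        using q by (simp add: divide_ennreal_def ennpowr_mult_distrib)
      also have "\<dots> = (\<phi> s * inverse (\<phi> s)) ennpowr q"
        using q by (subst nn_integral_multc) (auto simp: ennpowr_mult_distrib \<phi>q)
      also have "\<dots> \<le> 1 ennpowr q"
      proof (intro ennpowr_mono)
        \<comment> \<open>The product is 1 for finite positive \<open>\<phi> s\<close>, but
          \<open>0\<close> at both \<open>0\<close> and \<open>top\<close>; hence an
          inequality.\<close>
        show "\<phi> s * inverse (\<phi> s) \<le> 1"
          unfolding divide_ennreal_def[symmetric]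
          by (cases "\<phi> s = 0"; cases "\<phi> s = top") (auto simp: less_top)
      qed (use q in auto)
      finally show "(\<integral>\<^sup>+ x. (F x s / \<phi> s) ennpowr q \<partial>N) \<le> 1"
        using q ennpowr_ennreal[of 1 q] by simp
    qed auto
    also have "\<dots> = S ennpowr q"
    proof -
      obtain r where r: "r > 0" "S = ennreal r"
        using 3 by (cases S) (auto simp: ennreal_eq_0_iff less_le)
      then show ?thesis
        unfolding mult_1_right S_def[symmetric]
        by (simp add: ennpowr_ennreal_pos ennreal_mult[symmetric] powr_diff)
    qed
    finally show ?thesis .
  qed
  then have "(\<integral>\<^sup>+ x. (\<integral>\<^sup>+ s. F x s \<partial>M) ennpowr q \<partial>N) ennpowr (1 / q) \<le> (S ennpowr q) ennpowr (1 / q)"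
    using q by (intro ennpowr_mono) auto
  then show ?thesis
    using q by (simp add: ennpowr_ennpowr S_def \<phi>_def)
qed

section \<open>Mixed norms of nonnegative extended functions\<close>

definition mixed_nn_norm ::
  "real \<Rightarrow> real \<Rightarrow> 'a measure \<Rightarrow> 'b measure \<Rightarrow> ('a \<times> 'b \<Rightarrow> ennreal) \<Rightarrow> ennreal" where
  "mixed_nn_norm q1 q2 N1 N2 G =
     (\<integral>\<^sup>+ y. (\<integral>\<^sup>+ x. G (x, y) ennpowr q1 \<partial>N1) ennpowr (q2 / q1) \<partial>N2) ennpowr (1 / q2)"

text \<open>The majorants used below may be infinite at some points, so the estimates are made for
  \<open>mixed_nn_norm\<close>; this identity leads back to complex functions.\<close>

lemma mixed_norm_eq_mixed_nn_norm:
  "mixed_norm q1 q2 N1 N2 f = mixed_nn_norm q1 q2 N1 N2 (\<lambda>z. ennreal (cmod (f z)))"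
  by (simp add: mixed_norm_def mixed_nn_norm_def)

lemma mixed_nn_norm_Minkowski:
  fixes F :: "'a \<times> 'b \<Rightarrow> 'c \<Rightarrow> ennreal"
  assumes M: "sigma_finite_measure M" and N1: "sigma_finite_measure N1" and N2: "sigma_finite_measure N2"
    and F: "case_prod F \<in> borel_measurable ((N1 \<Otimes>\<^sub>M N2) \<Otimes>\<^sub>M M)" and q: "q1 \<ge> 1" "q2 \<ge> 1"
  shows "mixed_nn_norm q1 q2 N1 N2 (\<lambda>z. \<integral>\<^sup>+ s. F z s \<partial>M)
           \<le> (\<integral>\<^sup>+ s. mixed_nn_norm q1 q2 N1 N2 (\<lambda>z. F z s) \<partial>M)"
proof -
  interpret M: sigma_finite_measure M by fact
  interpret N1: sigma_finite_measure N1 by fact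
  interpret N2: sigma_finite_measure N2 by fact
  note [measurable] = F
  \<comment> \<open>The exponent \<open>q2 / q1\<close> may be below 1. Split this way, the inner
    integral becomes an \<open>L\<close>-norm with exponent \<open>q1\<close> raised to the power
    \<open>q2\<close>, so Minkowski applies with \<open>q1\<close> and then with
    \<open>q2\<close>.\<close>
  have pow: "z ennpowr (q2 / q1) = (z ennpowr (1 / q1)) ennpowr q2" for z
    using q by (simp add: ennpowr_ennpowr)
  have "(\<integral>\<^sup>+ y. (\<integral>\<^sup>+ x. (\<integral>\<^sup>+ s. F (x, y) s \<partial>M) ennpowr q1 \<partial>N1) ennpowr (q2 / q1) \<partial>N2)
      \<le> (\<integral>\<^sup>+ y. (\<integral>\<^sup>+ s. (\<integral>\<^sup>+ x. F (x, y) s ennpowr q1 \<partial>N1) ennpowr (1 / q1) \<partial>M) ennpowr q2 \<partial>N2)"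
  proof (rule nn_integral_mono)
    fix y assume [measurable]: "y \<in> space N2"
    show "(\<integral>\<^sup>+ x. (\<integral>\<^sup>+ s. F (x, y) s \<partial>M) ennpowr q1 \<partial>N1) ennpowr (q2 / q1)
      \<le> (\<integral>\<^sup>+ s. (\<integral>\<^sup>+ x. F (x, y) s ennpowr q1 \<partial>N1) ennpowr (1 / q1) \<partial>M) ennpowr q2"
      unfolding pow using q
      by (intro ennpowr_mono nn_integral_Minkowski[OF M N1]) auto
  qed
  then have "mixed_nn_norm q1 q2 N1 N2 (\<lambda>z. \<integral>\<^sup>+ s. F z s \<partial>M)
      \<le> (\<integral>\<^sup>+ y. (\<integral>\<^sup>+ s. (\<integral>\<^sup>+ x. F (x, y) s ennpowr q1 \<partial>N1) ennpowr (1 / q1) \<partial>M) ennpowr q2 \<partial>N2)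
          ennpowr (1 / q2)"
    unfolding mixed_nn_norm_def using q by (intro ennpowr_mono) auto
  also have "\<dots> \<le> (\<integral>\<^sup>+ s. (\<integral>\<^sup>+ y. ((\<integral>\<^sup>+ x. F (x, y) s ennpowr q1 \<partial>N1) ennpowr (1 / q1)) ennpowr q2 \<partial>N2)
      ennpowr (1 / q2) \<partial>M)"
    using q by (intro nn_integral_Minkowski[OF M N2]) auto
  finally show ?thesis unfolding mixed_nn_norm_def pow .
qed

lemma mixed_nn_norm_mono_AE:
  assumes "sigma_finite_measure N1" "sigma_finite_measure N2"
    and [measurable]: "F \<in> borel_measurable (N1 \<Otimes>\<^sub>M N2)" "G \<in> borel_measurable (N1 \<Otimes>\<^sub>M N2)"
    and le: "AE z in N1 \<Otimes>\<^sub>M N2. F z \<le> G z" and q: "q1 > 0" "q2 > 0"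
  shows "mixed_nn_norm q1 q2 N1 N2 F \<le> mixed_nn_norm q1 q2 N1 N2 G"
proof -
  interpret N1: sigma_finite_measure N1 by fact
  interpret N2: sigma_finite_measure N2 by fact
  interpret P: pair_sigma_finite N1 N2 ..
  \<comment> \<open>A product null set gives sections for almost every \<open>x\<close> first,
    whereas the norm integrates over \<open>x\<close> innermost; hence the exchange.\<close>
  have "AE y in N2. AE x in N1. F (x, y) \<le> G (x, y)"
    using P.AE_pair[OF le] by (subst P.AE_commute[symmetric]) auto
  then show ?thesis
    unfolding mixed_nn_norm_def using q
    by (intro ennpowr_mono nn_integral_mono_AE)
       (auto elim!: eventually_mono intro!: ennpowr_mono nn_integral_mono_AE)
qed

lemma mixed_nn_norm_cmult:
  assumes "sigma_finite_measure N1" and [measurable]: "G \<in> borel_measurable (N1 \<Otimes>\<^sub>M N2)"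
    and q: "q1 > 0" "q2 > 0"
  shows "mixed_nn_norm q1 q2 N1 N2 (\<lambda>z. c * G z) = c * mixed_nn_norm q1 q2 N1 N2 G"
proof -
  interpret N1: sigma_finite_measure N1 by fact
  have "mixed_nn_norm q1 q2 N1 N2 (\<lambda>z. c * G z)
      = (\<integral>\<^sup>+ y. (c ennpowr q1 * (\<integral>\<^sup>+ x. G (x, y) ennpowr q1 \<partial>N1)) ennpowr (q2 / q1) \<partial>N2) ennpowr (1 / q2)"
    unfolding mixed_nn_norm_def using q
    by (simp add: ennpowr_mult_distrib nn_integral_cmult cong: nn_integral_cong)
  also have "\<dots> = c * mixed_nn_norm q1 q2 N1 N2 G"
    unfolding mixed_nn_norm_def using q
    by (simp add: ennpowr_mult_distrib nn_integral_cmult ennpowr_ennpowr)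
  finally show ?thesis .
qed

lemma mixed_norm_1_1:
  assumes "sigma_finite_measure M1" "sigma_finite_measure M2"
    and [measurable]: "f \<in> borel_measurable (M1 \<Otimes>\<^sub>M M2)"
  shows "mixed_norm 1 1 M1 M2 f = (\<integral>\<^sup>+ w. ennreal (cmod (f w)) \<partial>(M1 \<Otimes>\<^sub>M M2))"
proof -
  interpret M1: sigma_finite_measure M1 by fact
  interpret M2: sigma_finite_measure M2 by fact
  interpret P: pair_sigma_finite M1 M2 ..
  show ?thesis
    unfolding mixed_norm_def using P.nn_integral_snd[of "\<lambda>w. ennreal (cmod (f w))"] by simp
qed

text \<open>A finite integral forces a finite integrand almost everywhere, used first in
  \<open>y\<close> and then in \<open>x\<close>. This is how a norm bound yields absolute
  convergence of the kernel integral.\<close>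

lemma AE_finite_of_mixed_nn_norm_finite:
  assumes "sigma_finite_measure N1" "sigma_finite_measure N2"
    and [measurable]: "G \<in> borel_measurable (N1 \<Otimes>\<^sub>M N2)"
    and fin: "mixed_nn_norm q1 q2 N1 N2 G < top" and q: "q1 > 0" "q2 > 0"
  shows "AE z in N1 \<Otimes>\<^sub>M N2. G z < top"
proof -
  interpret N1: sigma_finite_measure N1 by fact
  interpret N2: sigma_finite_measure N2 by fact
  interpret P: pair_sigma_finite N1 N2 ..
  have "AE y in N2. (\<integral>\<^sup>+ x. G (x, y) ennpowr q1 \<partial>N1) ennpowr (q2 / q1) \<noteq> \<infinity>"
    using fin q unfolding mixed_nn_norm_def
    by (intro nn_integral_PInf_AE) (auto simp: less_top[symmetric] ennpowr_eq_top_iff)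
  then have "AE y in N2. AE x in N1. G (x, y) < top"
    using AE_space
  proof eventually_elim
    case (elim y)
    note [measurable] = \<open>y \<in> space N2\<close>
    have "AE x in N1. G (x, y) ennpowr q1 \<noteq> \<infinity>"
      using elim q by (intro nn_integral_PInf_AE) (auto simp: ennpowr_eq_top_iff)
    then show ?case
      by eventually_elim (use q in \<open>auto simp: ennpowr_eq_top_iff less_top\<close>)
  qed
  then have "AE x in N1. AE y in N2. G (x, y) < top"
    by (subst P.AE_commute) auto
  then show ?thesis
    by (intro P.AE_pair_measure) auto
qed

section \<open>Pointwise bounds for kernels and Bochner integrals\<close>

lemma kernel_le_of_weight_bound:
  fixes k1 k2 a b h :: real
  assumes "0 \<le> k1" "0 \<le> k2" "0 < h" "0 \<le> a" "0 \<le> b" "\<gamma>1 + \<delta>1 = 1" "\<gamma>2 + \<delta>2 = 1"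
    and le: "ennreal k1 ennpowr \<gamma>1 * ennreal k2 ennpowr \<gamma>2 * ennreal h \<le> ennreal b"
  shows "ennreal (k1 * k2 * a)
    \<le> ennreal b * (ennreal k1 ennpowr \<delta>1 * ennreal k2 ennpowr \<delta>2) * ennreal (a / h)"
\<comment> \<open>A vanishing kernel value makes the left side 0. For positive values
  \<open>ennpowr\<close> agrees with \<open>powr\<close>, where exponents of any sign add.\<close>
proof (cases "k1 = 0 \<or> k2 = 0")
  case False
  then have k: "k1 > 0" "k2 > 0" using assms by auto
  \<comment> \<open>The powers with \<open>\<gamma>1\<close>, \<open>\<gamma>2\<close> are absorbed
    into \<open>b\<close> together with \<open>h\<close>; those with \<open>\<delta>1\<close>,
    \<open>\<delta>2\<close> remain, and \<open>a = h * (a / h)\<close> supplies the weight.\<close>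
  have pow: "k1 = k1 powr \<gamma>1 * k1 powr \<delta>1" "k2 = k2 powr \<gamma>2 * k2 powr \<delta>2"
    using k assms by (simp_all add: powr_add[symmetric])
  have "k1 powr \<gamma>1 * k2 powr \<gamma>2 * h \<le> b"
    using le k assms by (simp add: ennpowr_ennreal_pos ennreal_mult[symmetric])
  then have "(k1 powr \<gamma>1 * k2 powr \<gamma>2 * h) * (k1 powr \<delta>1 * k2 powr \<delta>2 * (a / h))
      \<le> b * (k1 powr \<delta>1 * k2 powr \<delta>2 * (a / h))"
    using assms by (intro mult_right_mono) auto
  also have "(k1 powr \<gamma>1 * k2 powr \<gamma>2 * h) * (k1 powr \<delta>1 * k2 powr \<delta>2 * (a / h))
      = (k1 powr \<gamma>1 * k1 powr \<delta>1) * (k2 powr \<gamma>2 * k2 powr \<delta>2) * a"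
    using assms by simp
  finally show ?thesis
    unfolding pow[symmetric] using k assms
    by (simp add: ennpowr_ennreal_pos ennreal_mult[symmetric] ennreal_leI mult.assoc)
qed auto

text \<open>For a non-integrable function the left side is 0 by the default value of the Bochner
  integral.\<close>

lemma norm_integral_le_nn_integral:
  fixes f :: "'a \<Rightarrow> 'b::{banach, second_countable_topology}"
  shows "ennreal (norm (LINT x|M. f x)) \<le> (\<integral>\<^sup>+ x. ennreal (norm (f x)) \<partial>M)"
  by (cases "integrable M f") (auto simp: integral_norm_bound_ennreal not_integrable_integral_eq)

section \<open>Boundedness of the kernel operator\<close>

theorem proposition3p2:
  fixes X M1 M2 N1 N2 :: "'a measure"
    and K1 K2 h1 h2 :: "'a \<times> 'a \<Rightarrow> real"
    and q1 q2 \<gamma>1 \<gamma>2 \<delta>1 \<delta>2 C1 C2 :: real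
  assumes "sigma_finite_measure M1" and "sets M1 = sets X"
    and "sigma_finite_measure M2" and "sets M2 = sets X"
    and "sigma_finite_measure N1" and "sets N1 = sets X"
    and "sigma_finite_measure N2" and "sets N2 = sets X"
    and "K1 \<in> borel_measurable (X \<Otimes>\<^sub>M X)" and "\<And>z. z \<in> space (X \<Otimes>\<^sub>M X) \<Longrightarrow> K1 z \<ge> 0"
    and "K2 \<in> borel_measurable (X \<Otimes>\<^sub>M X)" and "\<And>z. z \<in> space (X \<Otimes>\<^sub>M X) \<Longrightarrow> K2 z \<ge> 0"
    and "q1 \<ge> 1" and "q2 \<ge> 1"
    and "\<gamma>1 + \<delta>1 = 1" and "\<gamma>2 + \<delta>2 = 1"
    and "h1 \<in> borel_measurable (X \<Otimes>\<^sub>M X)" and "\<And>z. z \<in> space (X \<Otimes>\<^sub>M X) \<Longrightarrow> h1 z > 0"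
    and "h2 \<in> borel_measurable (X \<Otimes>\<^sub>M X)" and "\<And>z. z \<in> space (X \<Otimes>\<^sub>M X) \<Longrightarrow> h2 z > 0"
    and "C1 > 0" and "C2 > 0"
    and "AE (x, y) in N1 \<Otimes>\<^sub>M N2.
           esssup (M1 \<Otimes>\<^sub>M M2)
             (\<lambda>(s, t). ennreal (K1 (x, s)) ennpowr \<gamma>1 * ennreal (K2 (y, t)) ennpowr \<gamma>2
                         * ennreal (h1 (s, t)))
           \<le> ennreal (C1 * h2 (x, y))"
    and "AE (s, t) in M1 \<Otimes>\<^sub>M M2.
           (\<integral>\<^sup>+ y. (\<integral>\<^sup>+ x. ennreal (K1 (x, s)) ennpowr (\<delta>1 * q1)
                            * ennreal (K2 (y, t)) ennpowr (\<delta>2 * q1)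
                            * ennreal (h2 (x, y)) ennpowr q1 \<partial>N1) ennpowr (q2 / q1) \<partial>N2)
           \<le> ennreal C2 * ennreal (h1 (s, t)) ennpowr q2"
  shows "(\<forall>f \<in> mixed_Lp 1 1 M1 M2. AE z in N1 \<Otimes>\<^sub>M N2.
            integrable (M1 \<Otimes>\<^sub>M M2) (kernel_integrand K1 K2 f z))
       \<and> mixed_bounded 1 1 M1 M2 q1 q2 N1 N2 (kernel_operator M1 M2 K1 K2)
       \<and> mixed_opnorm 1 1 M1 M2 q1 q2 N1 N2 (kernel_operator M1 M2 K1 K2)
           \<le> ennreal (C1 * C2 powr (1 / q2))"
proof -
  interpret M1: sigma_finite_measure M1 by fact
  interpret M2: sigma_finite_measure M2 by fact
  interpret N1: sigma_finite_measure N1 by fact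
  interpret N2: sigma_finite_measure N2 by fact
  interpret M: pair_sigma_finite M1 M2 ..
  note [measurable_cong] = \<open>sets M1 = sets X\<close> \<open>sets M2 = sets X\<close> \<open>sets N1 = sets X\<close> \<open>sets N2 = sets X\<close>
  note [measurable] = \<open>K1 \<in> _\<close> \<open>K2 \<in> _\<close> \<open>h1 \<in> _\<close> \<open>h2 \<in> _\<close>
  have [simp]: "space M1 = space X" "space M2 = space X" "space N1 = space X" "space N2 = space X"
    using assms(2,4,6,8) by (auto dest: sets_eq_imp_space_eq)
  have K1_nonneg: "0 \<le> K1 (x, s)" and K2_nonneg: "0 \<le> K2 (x, s)"
    and h1_pos: "0 < h1 (x, s)" and h2_pos: "0 < h2 (x, s)"
    if "x \<in> space X" "s \<in> space X" for x s
    using that assms(10,12,18,20) by (auto simp: space_pair_measure)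
  have q: "q1 > 0" "q2 > 0" using \<open>q1 \<ge> 1\<close> \<open>q2 \<ge> 1\<close> by auto
  have sf: "sigma_finite_measure (M1 \<Otimes>\<^sub>M M2)" by (rule M.sigma_finite_measure_axioms)
  let ?M = "M1 \<Otimes>\<^sub>M M2" and ?N = "N1 \<Otimes>\<^sub>M N2"
  let ?k = "kernel_integrand K1 K2" and ?T = "kernel_operator M1 M2 K1 K2"
  let ?L = "mixed_Lp 1 1 M1 M2" and ?C = "C1 * C2 powr (1 / q2)"

  \<comment> \<open>\<open>G f\<close> is the operator with absolute values inside, possibly
    infinite. One bound on its norm gives both absolute convergence almost everywhere and the bound
    on \<open>?T f\<close>.\<close>
  define G where "G f z = (\<integral>\<^sup>+ w. ennreal (cmod (?k f z w)) \<partial>?M)" for f z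
  \<comment> \<open>For fixed \<open>w = (s, t)\<close>, the mixed norm of \<open>A\<close> in
    \<open>z\<close> is the left side of the second kernel hypothesis raised to the power
    \<open>1 / q2\<close>.\<close>
  define A where "A z w = ennreal (K1 (fst z, fst w)) ennpowr \<delta>1 * ennreal (K2 (snd z, snd w)) ennpowr \<delta>2
    * ennreal (h2 z)" for z w
  have [measurable]: "(\<lambda>(z, w). A z w) \<in> borel_measurable (?N \<Otimes>\<^sub>M ?M)"
    unfolding A_def by measurable

  have k_meas [measurable]: "(\<lambda>(z, w). ?k f z w) \<in> borel_measurable (?N \<Otimes>\<^sub>M ?M)"
    if [measurable]: "f \<in> borel_measurable ?M" for f
  proof -
    have "(\<lambda>(z, w). ?k f z w) = (\<lambda>(z, w). complex_of_real (K1 (fst z, fst w))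
        * complex_of_real (K2 (snd z, snd w)) * f w)"
      by (auto simp: kernel_integrand_def)
    then show ?thesis by simp
  qed
  have G_meas: "G f \<in> borel_measurable ?N" if "f \<in> borel_measurable ?M" for f
  proof -
    interpret P: sigma_finite_measure ?M by (rule sf)
    note [measurable] = k_meas[OF that]
    show ?thesis unfolding G_def by measurable
  qed
  have T_meas: "?T f \<in> borel_measurable ?N" if "f \<in> borel_measurable ?M" for f
  proof -
    note [measurable] = k_meas[OF that]
    show ?thesis unfolding kernel_operator_def by measurable
  qed

  have A_norm: "AE w in ?M. mixed_nn_norm q1 q2 N1 N2 (\<lambda>z. A z w) \<le> ennreal (C2 powr (1 / q2) * h1 w)"
    using assms(24) AE_space
  proof eventually_elim
    case (elim w)
    obtain s t where w: "w = (s, t)" by force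
    have h: "0 < h1 w" using elim(2) h1_pos by (auto simp: w space_pair_measure)
    have "mixed_nn_norm q1 q2 N1 N2 (\<lambda>z. A z w) \<le> (ennreal C2 * ennreal (h1 w) ennpowr q2) ennpowr (1 / q2)"
      unfolding mixed_nn_norm_def using q elim
      by (intro ennpowr_mono) (auto simp: A_def w ennpowr_mult_distrib ennpowr_ennpowr)
    also have "\<dots> = ennreal (C2 powr (1 / q2) * h1 w)"
      using q h \<open>C2 > 0\<close> by (simp add: ennpowr_mult_distrib ennpowr_ennpowr ennpowr_ennreal powr_powr ennreal_mult)
    finally show ?case .
  qed

  have G_bound: "AE z in ?N. G f z \<le> (\<integral>\<^sup>+ w. ennreal C1 * ennreal (cmod (f w) / h1 w) * A z w \<partial>?M)" for f
    using assms(23) AE_space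
  proof eventually_elim
    case (elim z)
    obtain x y where z: "z = (x, y)" by force
    have xy: "x \<in> space X" "y \<in> space X" using elim(2) by (auto simp: z space_pair_measure)
    note bound = elim(1)
    \<comment> \<open>The exceptional set of \<open>w\<close> depends on \<open>z\<close>, which is
      harmless because \<open>w\<close> is integrated out with \<open>z\<close> fixed.\<close>
    have "AE w in ?M. ennreal (K1 (x, fst w)) ennpowr \<gamma>1 * ennreal (K2 (y, snd w)) ennpowr \<gamma>2 * ennreal (h1 w)
        \<le> ennreal (C1 * h2 z)"
      using esssup_AE[of "\<lambda>(s, t). ennreal (K1 (x, s)) ennpowr \<gamma>1 * ennreal (K2 (y, t)) ennpowr \<gamma>2
        * ennreal (h1 (s, t))" ?M]
    proof eventually_elim
      case (elim w)
      then show ?case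
        using bound by (cases w) (auto simp: z intro: order_trans)
    qed
    then have "AE w in ?M. ennreal (cmod (?k f z w)) \<le> ennreal C1 * ennreal (cmod (f w) / h1 w) * A z w"
      using AE_space
    proof eventually_elim
      case (elim w)
      obtain s t where w: "w = (s, t)" by force
      have st: "s \<in> space X" "t \<in> space X" using elim(2) by (auto simp: w space_pair_measure)
      have "cmod (?k f z w) = K1 (x, s) * K2 (y, t) * cmod (f w)"
        using K1_nonneg[OF xy(1) st(1)] K2_nonneg[OF xy(2) st(2)]
        by (simp add: kernel_integrand_def z w norm_mult)
      moreover have "ennreal (K1 (x, s) * K2 (y, t) * cmod (f w))
          \<le> ennreal (C1 * h2 z) * (ennreal (K1 (x, s)) ennpowr \<delta>1 * ennreal (K2 (y, t)) ennpowr \<delta>2)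
            * ennreal (cmod (f w) / h1 w)"
        using elim(1) K1_nonneg[OF xy(1) st(1)] K2_nonneg[OF xy(2) st(2)] h1_pos[OF st] h2_pos[OF xy] assms(15,16) \<open>C1 > 0\<close>
        by (intro kernel_le_of_weight_bound) (auto simp: z w)
      moreover have "ennreal (C1 * h2 z) = ennreal C1 * ennreal (h2 z)"
        using \<open>C1 > 0\<close> h2_pos[OF xy] by (simp add: z ennreal_mult)
      ultimately show ?case
        by (simp add: A_def z w mult_ac)
    qed
    then show ?case unfolding G_def by (rule nn_integral_mono_AE)
  qed

  have G_norm: "mixed_nn_norm q1 q2 N1 N2 (G f) \<le> ennreal ?C * mixed_norm 1 1 M1 M2 f"
    if f [measurable]: "f \<in> borel_measurable ?M" for f
  proof -
    interpret P: sigma_finite_measure ?M by (rule sf)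
    have "mixed_nn_norm q1 q2 N1 N2 (G f)
        \<le> mixed_nn_norm q1 q2 N1 N2 (\<lambda>z. \<integral>\<^sup>+ w. ennreal C1 * ennreal (cmod (f w) / h1 w) * A z w \<partial>?M)"
      using G_bound[of f] q G_meas[OF f]
      by (intro mixed_nn_norm_mono_AE[OF assms(5,7)]) auto
    \<comment> \<open>The pair \<open>(s, t)\<close> acts as a single variable \<open>w\<close> over
      the product measure; \<open>mixed_norm_1_1\<close> turns the resulting integral back into a
      mixed norm.\<close>
    also have "\<dots> \<le> (\<integral>\<^sup>+ w. mixed_nn_norm q1 q2 N1 N2
        (\<lambda>z. ennreal C1 * ennreal (cmod (f w) / h1 w) * A z w) \<partial>?M)"
      using assms(13,14) by (intro mixed_nn_norm_Minkowski[OF sf assms(5,7)]) auto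
    also have "\<dots> = (\<integral>\<^sup>+ w. ennreal C1 * ennreal (cmod (f w) / h1 w) *
        mixed_nn_norm q1 q2 N1 N2 (\<lambda>z. A z w) \<partial>?M)"
      using q by (intro nn_integral_cong mixed_nn_norm_cmult[OF assms(5)]) auto
    also have "\<dots> \<le> (\<integral>\<^sup>+ w. ennreal ?C * ennreal (cmod (f w)) \<partial>?M)"
    proof (rule nn_integral_mono_AE)
      show "AE w in ?M. ennreal C1 * ennreal (cmod (f w) / h1 w) * mixed_nn_norm q1 q2 N1 N2 (\<lambda>z. A z w)
          \<le> ennreal ?C * ennreal (cmod (f w))"
        using A_norm AE_space
      proof eventually_elim
        case (elim w)
        have h: "0 < h1 w" using elim(2) h1_pos by (cases w) (auto simp: space_pair_measure)
        have "ennreal C1 * ennreal (cmod (f w) / h1 w) * mixed_nn_norm q1 q2 N1 N2 (\<lambda>z. A z w)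
            \<le> ennreal C1 * ennreal (cmod (f w) / h1 w) * ennreal (C2 powr (1 / q2) * h1 w)"
          using elim(1) by (rule mult_left_mono) simp
        also have "\<dots> = ennreal ?C * ennreal (cmod (f w))"
          using h \<open>C1 > 0\<close> by (simp add: ennreal_mult[symmetric])
        finally show ?case .
      qed
    qed
    also have "\<dots> = ennreal ?C * mixed_norm 1 1 M1 M2 f"
      using f by (simp add: nn_integral_cmult mixed_norm_1_1[OF assms(1,3)])
    finally show ?thesis .
  qed

  \<comment> \<open>This holds at every point, even where the integrals defining
    \<open>?T f z\<close> do not converge absolutely, since the default value 0 only helps.\<close>
  have T_le_G: "ennreal (cmod (?T f z)) \<le> G f z"
    if f: "f \<in> borel_measurable ?M" and z: "z \<in> space ?N" for f z
  proof -
    note [measurable] = k_meas[OF f] z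
    have "ennreal (cmod (?T f z)) \<le> (\<integral>\<^sup>+ t. ennreal (cmod (LINT s|M1. ?k f z (s, t))) \<partial>M2)"
      unfolding kernel_operator_def by (rule norm_integral_le_nn_integral)
    also have "\<dots> \<le> (\<integral>\<^sup>+ t. (\<integral>\<^sup>+ s. ennreal (cmod (?k f z (s, t))) \<partial>M1) \<partial>M2)"
      by (intro nn_integral_mono norm_integral_le_nn_integral)
    also have "\<dots> = G f z"
      unfolding G_def by (rule M.nn_integral_snd) measurable
    finally show ?thesis .
  qed

  have T_norm: "mixed_norm q1 q2 N1 N2 (?T f) \<le> ennreal ?C * mixed_norm 1 1 M1 M2 f"
    if f: "f \<in> borel_measurable ?M" for f
  proof -
    have "mixed_norm q1 q2 N1 N2 (?T f) \<le> mixed_nn_norm q1 q2 N1 N2 (G f)"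
      unfolding mixed_norm_eq_mixed_nn_norm using q T_meas[OF f] G_meas[OF f] T_le_G[OF f]
      by (intro mixed_nn_norm_mono_AE[OF assms(5,7)] AE_I2) auto
    also have "\<dots> \<le> ennreal ?C * mixed_norm 1 1 M1 M2 f"
      by (rule G_norm[OF f])
    finally show ?thesis .
  qed

  have L_meas: "f \<in> borel_measurable ?M" and L_fin: "ennreal ?C * mixed_norm 1 1 M1 M2 f < top" if "f \<in> ?L" for f
    using that by (auto simp: mixed_Lp_def ennreal_mult_less_top)

  have integrable_k: "AE z in ?N. integrable ?M (?k f z)" if f: "f \<in> ?L" for f
  proof -
    note [measurable] = k_meas[OF L_meas[OF f]]
    have "AE z in ?N. G f z < top"
      using G_norm[OF L_meas[OF f]] L_fin[OF f] q G_meas[OF L_meas[OF f]]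
      by (intro AE_finite_of_mixed_nn_norm_finite[OF assms(5,7), of _ q1 q2]) auto
    then show ?thesis
      using AE_space
    proof eventually_elim
      case (elim z)
      note [measurable] = elim(2)
      show ?case
        using elim(1) unfolding G_def by (intro integrableI_bounded) auto
    qed
  qed

  \<comment> \<open>Additivity is read off the joint integral, where integrability over the product
    suffices; the iterated form would need integrability of sections as well.\<close>
  have T_eq: "?T f z = (LINT w|?M. ?k f z w)" if "integrable ?M (?k f z)" for f z
    using M.integral_snd[of "\<lambda>s t. ?k f z (s, t)"] that
    by (simp add: kernel_operator_def)

  have T_add: "AE z in ?N. ?T (\<lambda>w. f w + g w) z = ?T f z + ?T g z" if f: "f \<in> ?L" and g: "g \<in> ?L" for f g
    using integrable_k[OF f] integrable_k[OF g]
  proof eventually_elim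
    case (elim z)
    have "?k (\<lambda>w. f w + g w) z = (\<lambda>w. ?k f z w + ?k g z w)"
      by (auto simp: kernel_integrand_def split_beta algebra_simps)
    then show ?case
      using elim by (simp add: T_eq)
  qed

  \<comment> \<open>Unlike additivity this is true at every point: a scalar can be pulled out of a
    Bochner integral whether or not it converges.\<close>
  have T_scale: "?T (\<lambda>w. c * f w) z = c * ?T f z" for c f z
  proof -
    have "?k (\<lambda>w. c * f w) z w = c * ?k f z w" for w
      by (auto simp: kernel_integrand_def split_beta)
    then show ?thesis by (simp add: kernel_operator_def)
  qed

  have T_Lp: "?T f \<in> mixed_Lp q1 q2 N1 N2" if f: "f \<in> ?L" for f
    using T_norm[OF L_meas[OF f]] L_fin[OF f] T_meas[OF L_meas[OF f]]
    by (auto simp: mixed_Lp_def)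

  have "mixed_bounded 1 1 M1 M2 q1 q2 N1 N2 ?T"
    unfolding mixed_bounded_def using T_Lp T_add T_scale T_norm[OF L_meas] by (auto intro!: exI[of _ "?C"])
  moreover have "mixed_opnorm 1 1 M1 M2 q1 q2 N1 N2 ?T \<le> ennreal ?C"
    unfolding mixed_opnorm_def
  proof (rule SUP_least, clarify)
    fix f assume f: "f \<in> ?L" "mixed_norm 1 1 M1 M2 f \<le> 1"
    have "mixed_norm q1 q2 N1 N2 (?T f) \<le> ennreal ?C * mixed_norm 1 1 M1 M2 f"
      by (rule T_norm[OF L_meas[OF f(1)]])
    also have "\<dots> \<le> ennreal ?C * 1"
      using f(2) by (rule mult_left_mono) simp
    finally show "mixed_norm q1 q2 N1 N2 (?T f) \<le> ennreal ?C" by simp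
  qed
  ultimately show ?thesis using integrable_k by blast
qed

end
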